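(* Let $\mathbb{F}$ be a field in which every quadratic and every cubic polynomial has a root, and let $\mathbb{A}$ be a two-dimensional algebra over $\mathbb{F}$ with basis $e_1,e_2$ and matrix of structure constants $A=\begin{pmatrix}\alpha_1&\alpha_2&\alpha_3&\alpha_4\\ \beta_1&\beta_2&\beta_3&\beta_4\end{pmatrix}$. Put $$p_A(y)=\alpha_4y^3+(\alpha_2+\alpha_3-\beta_4)y^2+(\alpha_1-\beta_2-\beta_3)y-\beta_1,\qquad \lambda_A(y)=\alpha_4y^2+(\alpha_2+\alpha_3)y+\alpha_1,$$ and let $Id(A)$ be the set of all idempotents of $\mathbb{A}$. - If $\alpha_4\neq0$, or $\alpha_4=0$ and $\beta_4=0$, then $$Id(A)=\Big\{\tfrac{1}{\lambda_A(y_0)}(e_1+y_0e_2):\ y_0\in\mathbb{F},\ p_A(y_0)=0,\ \lambda_A(y_0)\neq0\Big\}.$$ - If $\alpha_4=0$ and $\beta_4\neq0$, then $$Id(A)=\Big\{\tfrac{1}{\lambda_A(y_0)}(e_1+y_0e_2):\ y_0\in\mathbb{F},\ p_A(y_0)=0,\ \lambda_A(y_0)\neq0\Big\}\cup\Big\{\tfrac1{\beta_4}e_2\Big\}.$$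
   Context: An algebra is a vector space with a bilinear product (not necessarily associative, commutative or unital). An idempotent is a nonzero element $\mathbf v$ with $\mathbf v^2=\mathbf v$. The matrix of structure constants $A$ in the basis $e_1,e_2$ means $e_1e_1=\alpha_1e_1+\beta_1e_2$, $e_1e_2=\alpha_2e_1+\beta_2e_2$, $e_2e_1=\alpha_3e_1+\beta_3e_2$, $e_2e_2=\alpha_4e_1+\beta_4e_2$. *)

theory Defs
  imports "HOL-Analysis.Finite_Cartesian_Product" "HOL-Computational_Algebra.Polynomial"
begin

definition quadratics_and_cubics_have_roots :: "'f::field itself \<Rightarrow> bool" where
  "quadratics_and_cubics_have_roots _ \<longleftrightarrow>
     (\<forall>q :: 'f poly. degree q = 2 \<or> degree q = 3 \<longrightarrow> (\<exists>x. poly q x = 0))"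

locale nonassoc_algebra = vector_space scale
  for scale :: "'f::field \<Rightarrow> 'v::ab_group_add \<Rightarrow> 'v" +
  fixes prod :: "'v \<Rightarrow> 'v \<Rightarrow> 'v"
  assumes linear_prod_right: "Vector_Spaces.linear scale scale (\<lambda>v. prod u v)"
    and linear_prod_left: "Vector_Spaces.linear scale scale (\<lambda>u. prod u v)"
begin

definition basis_pair :: "'v \<Rightarrow> 'v \<Rightarrow> bool" where
  "basis_pair e1 e2 \<longleftrightarrow> e1 \<noteq> e2 \<and> independent {e1, e2} \<and> span {e1, e2} = UNIV"

text \<open>A 2 by 4 matrix has type \<open>'f^4^2\<close>: \<open>A $ 1 $ i\<close> is $\alpha_i$ and \<open>A $ 2 $ i\<close> is $\beta_i$.
  In the index types, \<open>4 = 0\<close> and \<open>2 = 0\<close>, respectively, which does not identify any of the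
  indices used.\<close>

definition structure_constants :: "'v \<Rightarrow> 'v \<Rightarrow> 'f^4^2 \<Rightarrow> bool" where
  "structure_constants e1 e2 A \<longleftrightarrow>
     prod e1 e1 = scale (A $ 1 $ 1) e1 + scale (A $ 2 $ 1) e2 \<and>
     prod e1 e2 = scale (A $ 1 $ 2) e1 + scale (A $ 2 $ 2) e2 \<and>
     prod e2 e1 = scale (A $ 1 $ 3) e1 + scale (A $ 2 $ 3) e2 \<and>
     prod e2 e2 = scale (A $ 1 $ 4) e1 + scale (A $ 2 $ 4) e2"

definition idempotents :: "'v set" where
  "idempotents = {v. v \<noteq> 0 \<and> prod v v = v}"

end

definition p_fun :: "'f::field^4^2 \<Rightarrow> 'f \<Rightarrow> 'f" where
  "p_fun A y = A $ 1 $ 4 * y ^ 3 + (A $ 1 $ 2 + A $ 1 $ 3 - A $ 2 $ 4) * y ^ 2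
     + (A $ 1 $ 1 - A $ 2 $ 2 - A $ 2 $ 3) * y - A $ 2 $ 1"

definition lambda_fun :: "'f::field^4^2 \<Rightarrow> 'f \<Rightarrow> 'f" where
  "lambda_fun A y = A $ 1 $ 4 * y ^ 2 + (A $ 1 $ 2 + A $ 1 $ 3) * y + A $ 1 $ 1"

end

theory Submission
  imports Defs
begin

text \<open>Write an idempotent as \<open>x e1 + z e2\<close> and compare coordinates of its square. If \<open>x = 0\<close>, then
  \<open>\<alpha>\<^sub>4 z\<^sup>2 = 0\<close> and \<open>z = \<beta>\<^sub>4 z\<^sup>2\<close>, which leaves only \<open>e2 / \<beta>\<^sub>4\<close>, and only if \<open>\<alpha>\<^sub>4 = 0 \<noteq> \<beta>\<^sub>4\<close>.
  If \<open>x \<noteq> 0\<close>, put \<open>z = x y\<close>: the first coordinate says \<open>x \<lambda>(y) = 1\<close> and the second \<open>x \<mu>(y) = y\<close>,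
  where \<open>p(y) = y \<lambda>(y) - \<mu>(y)\<close>.\<close>

context nonassoc_algebra
begin

text \<open>Bilinearity gives four products; \<open>e1 e2\<close> and \<open>e2 e1\<close> both
  carry the factor \<open>x * z\<close>, so their structure constants enter only through
  sums.\<close>

lemma square_eq:
  assumes "structure_constants e1 e2 A"
  shows "prod (scale x e1 + scale z e2) (scale x e1 + scale z e2) =
    scale (A $ 1 $ 1 * x\<^sup>2 + (A $ 1 $ 2 + A $ 1 $ 3) * x * z + A $ 1 $ 4 * z\<^sup>2) e1 +
    scale (A $ 2 $ 1 * x\<^sup>2 + (A $ 2 $ 2 + A $ 2 $ 3) * x * z + A $ 2 $ 4 * z\<^sup>2) e2"
proof -
  have r: "prod u (v + w) = prod u v + prod u w" "prod u (scale c v) = scale c (prod u v)" for u v w c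
    using linear_prod_right[of u]
    by (auto simp: Vector_Spaces.linear_iff)
  have l: "prod (v + w) u = prod v u + prod w u" "prod (scale c v) u = scale c (prod v u)" for u v w c
    using linear_prod_left[of u]
    by (auto simp: Vector_Spaces.linear_iff)
  show ?thesis
    using assms
    by (simp add: structure_constants_def r l scale_right_distrib scale_left_distrib
        power2_eq_square algebra_simps)
qed

lemma basis_pair_coords_eq_iff:
  assumes "basis_pair e1 e2"
  shows "scale x e1 + scale z e2 = scale x' e1 + scale z' e2 \<longleftrightarrow> x = x' \<and> z = z'"
proof
  assume eq: "scale x e1 + scale z e2 = scale x' e1 + scale z' e2"
  have ne: "e1 \<noteq> e2" and indep: "independent {e1, e2}"
    using assms by (auto simp: basis_pair_def)
  \<comment> \<open>Linear independence is phrased with a coefficient function on vectors; the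
    \<open>else\<close> branch serves \<open>e2\<close>, which is legitimate because
    \<open>e1 \<noteq> e2\<close>.\<close>
  define c where "c v = (if v = e1 then x - x' else z - z')" for v
  have "(\<Sum>v\<in>{e1, e2}. scale (c v) v) = 0"
    using ne eq by (simp add: c_def scale_left_diff_distrib algebra_simps)
  then have "c e1 = 0 \<and> c e2 = 0"
    using independentD[OF indep, of "{e1, e2}" c] by auto
  then show "x = x' \<and> z = z'"
    using ne by (simp add: c_def)
qed simp

lemma basis_pair_coords:
  assumes "basis_pair e1 e2"
  obtains x z where "v = scale x e1 + scale z e2"
proof -
  have "v \<in> span {e1, e2}"
    using assms by (simp add: basis_pair_def)
  then obtain x z where "v - scale x e1 = scale z e2"
    by (auto simp: span_insert)
  then have "v = scale x e1 + scale z e2"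
    by (simp add: algebra_simps)
  then show thesis
    by (rule that)
qed

lemma coords_in_idempotents_iff:
  assumes "basis_pair e1 e2" and "structure_constants e1 e2 A"
  shows "scale x e1 + scale z e2 \<in> idempotents \<longleftrightarrow> (x \<noteq> 0 \<or> z \<noteq> 0) \<and>
    A $ 1 $ 1 * x\<^sup>2 + (A $ 1 $ 2 + A $ 1 $ 3) * x * z + A $ 1 $ 4 * z\<^sup>2 = x \<and>
    A $ 2 $ 1 * x\<^sup>2 + (A $ 2 $ 2 + A $ 2 $ 3) * x * z + A $ 2 $ 4 * z\<^sup>2 = z"
  \<comment> \<open>Comparison with the coordinates \<open>0 0\<close> turns
    \<open>v \<noteq> 0\<close> into a condition on \<open>x\<close> and \<open>z\<close>.\<close>
  using basis_pair_coords_eq_iff[OF assms(1), of x z 0 0]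
  by (simp add: idempotents_def square_eq[OF assms(2)] basis_pair_coords_eq_iff[OF assms(1)])

lemma idempotent_e1_coord_zero_iff:
  assumes "basis_pair e1 e2" and "structure_constants e1 e2 A"
  shows "scale z e2 \<in> idempotents \<longleftrightarrow> A $ 1 $ 4 = 0 \<and> A $ 2 $ 4 \<noteq> 0 \<and> z = 1 / A $ 2 $ 4"
  using coords_in_idempotents_iff[OF assms, of 0 z]
  by (auto simp: power2_eq_square eq_divide_eq mult.commute)

lemma idempotent_e1_coord_nonzero_iff:
  assumes "basis_pair e1 e2" and "structure_constants e1 e2 A" and "x \<noteq> 0"
  shows "scale x (e1 + scale y e2) \<in> idempotents \<longleftrightarrow>
    p_fun A y = 0 \<and> lambda_fun A y \<noteq> 0 \<and> x = 1 / lambda_fun A y"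
proof -
  \<comment> \<open>\<open>lambda_fun A y\<close> and \<open>m\<close> are the two coordinates of
    the square of \<open>e1 + scale y e2\<close>. Thus \<open>p_fun A y = 0\<close> says that this
    square is a multiple of the vector itself.\<close>
  define m where "m = A $ 2 $ 1 + (A $ 2 $ 2 + A $ 2 $ 3) * y + A $ 2 $ 4 * y\<^sup>2"
  have p: "p_fun A y = y * lambda_fun A y - m"
    by (simp add: p_fun_def lambda_fun_def m_def algebra_simps power2_eq_square power3_eq_cube)
  have "A $ 1 $ 1 * x\<^sup>2 + (A $ 1 $ 2 + A $ 1 $ 3) * x * (x * y) + A $ 1 $ 4 * (x * y)\<^sup>2 =
      x * (x * lambda_fun A y)"
    by (simp add: lambda_fun_def algebra_simps power2_eq_square)
  moreover have "A $ 2 $ 1 * x\<^sup>2 + (A $ 2 $ 2 + A $ 2 $ 3) * x * (x * y) + A $ 2 $ 4 * (x * y)\<^sup>2 =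
      x * (x * m)"
    by (simp add: m_def algebra_simps power2_eq_square)
  ultimately have "scale x (e1 + scale y e2) \<in> idempotents \<longleftrightarrow>
      x * lambda_fun A y = 1 \<and> x * m = y"
    using coords_in_idempotents_iff[OF assms(1,2), of x "x * y"] \<open>x \<noteq> 0\<close>
    by (simp add: scale_right_distrib)
  also have "\<dots> \<longleftrightarrow> p_fun A y = 0 \<and> lambda_fun A y \<noteq> 0 \<and> x = 1 / lambda_fun A y"
  proof -
    \<comment> \<open>Since \<open>x * lambda_fun A y = 1\<close>, the right side \<open>y\<close>
      equals \<open>x * (y * lambda_fun A y)\<close>, and \<open>x\<close> cancels.\<close>
    have "x * m = y \<longleftrightarrow> m = y * lambda_fun A y" if "x * lambda_fun A y = 1"
      using that \<open>x \<noteq> 0\<close> by (metis mult.left_commute mult.right_neutral mult_left_cancel)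
    then show ?thesis
      by (auto simp: p eq_divide_eq)
  qed
  finally show ?thesis .
qed

text \<open>Both cases of the theorem at once: they differ only in whether the line spanned by
  \<open>e2\<close> contains an idempotent.\<close>

lemma idempotents_eq:
  assumes "basis_pair e1 e2" and "structure_constants e1 e2 A"
  shows "idempotents =
    {scale (1 / lambda_fun A y) (e1 + scale y e2) | y. p_fun A y = 0 \<and> lambda_fun A y \<noteq> 0} \<union>
    (if A $ 1 $ 4 = 0 \<and> A $ 2 $ 4 \<noteq> 0 then {scale (1 / A $ 2 $ 4) e2} else {})"
    (is "_ = ?L \<union> ?E")
proof (intro equalityI subsetI)
  fix v assume v: "v \<in> idempotents"
  obtain x z where xz: "v = scale x e1 + scale z e2"
    using basis_pair_coords[OF assms(1)] .
  show "v \<in> ?L \<union> ?E"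
  proof (cases "x = 0")
    case True
    then show ?thesis
      using v xz idempotent_e1_coord_zero_iff[OF assms, of z] by simp
  next
    case False
    then have "v = scale x (e1 + scale (z / x) e2)"
      by (simp add: xz scale_right_distrib)
    then have "v \<in> ?L"
      using v idempotent_e1_coord_nonzero_iff[OF assms False, of "z / x"]
      by (intro CollectI exI[of _ "z / x"]) metis
    then show ?thesis ..
  qed
next
  fix v assume "v \<in> ?L \<union> ?E"
  \<comment> \<open>The criterion for a nonzero \<open>e1\<close> coordinate applies because
    \<open>1 / lambda_fun A y\<close> is nonzero when \<open>lambda_fun A y\<close> is.\<close>
  then show "v \<in> idempotents"
    using idempotent_e1_coord_nonzero_iff[OF assms] idempotent_e1_coord_zero_iff[OF assms]
    by (auto split: if_splits)
qed

end

theorem proposition4p1: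
  fixes scale :: "'f::field \<Rightarrow> 'v::ab_group_add \<Rightarrow> 'v"
    and prod :: "'v \<Rightarrow> 'v \<Rightarrow> 'v"
    and e1 e2 :: 'v
    and A :: "'f^4^2"
  assumes "quadratics_and_cubics_have_roots TYPE('f)"
    and "nonassoc_algebra scale prod"
    and "nonassoc_algebra.basis_pair scale e1 e2"
    and "nonassoc_algebra.structure_constants scale prod e1 e2 A"
  shows "(A $ 1 $ 4 \<noteq> 0 \<or> A $ 1 $ 4 = 0 \<and> A $ 2 $ 4 = 0 \<longrightarrow>
           nonassoc_algebra.idempotents prod =
             {scale (1 / lambda_fun A y) (e1 + scale y e2) | y.
                p_fun A y = 0 \<and> lambda_fun A y \<noteq> 0}) \<and>
         (A $ 1 $ 4 = 0 \<and> A $ 2 $ 4 \<noteq> 0 \<longrightarrow>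
           nonassoc_algebra.idempotents prod =
             {scale (1 / lambda_fun A y) (e1 + scale y e2) | y.
                p_fun A y = 0 \<and> lambda_fun A y \<noteq> 0} \<union> {scale (1 / A $ 2 $ 4) e2})"
  using nonassoc_algebra.idempotents_eq[OF assms(2-4)] by auto

end
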